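(* Let $0<\mu\le L$ and let $f:\mathbb{R}^d\to\mathbb{R}$ be differentiable, $L$-smooth and $\mu$-strongly convex, with minimizer $x^*$ and $f^*=f(x^* )$. Let $0\le\nu\le\frac12$. Run the Intermediate Gradient Method (IGM, see context) from $x^0$ for $N$ steps with an inexact gradient $\widetilde\nabla f$ satisfying $\|\widetilde\nabla f(y^k)-\nabla f(y^k)\|_2\le\Delta_k$ for $k=0,\dots,N-1$. With $R:=\|x^0-x^*\|_2$, the output $x^N$ satisfies $$f(x^N)-f^*\le\left(1-\tfrac18\left(\tfrac{\mu}{2L}\right)^{1-\nu}\right)^N\left(f(x^0)-f^*+\tfrac{\mu}{4}R^2\right)+3\left(\tfrac{\mu}{L}\right)^{1-2\nu}\sum_{k=0}^{N-1}\left(1-\tfrac18\left(\tfrac{\mu}{2L}\right)^{1-\nu}\right)^{N-k-1}\frac{\Delta_k^2}{\mu},$$ and the right-hand side is at most $$\left(1-\tfrac1{16}\left(\tfrac{\mu}{L}\right)^{1-\nu}\right)^N LR^2+3\left(\tfrac{\mu}{L}\right)^{1-2\nu}\sum_{k=0}^{N-1}\left(1-\tfrac1{16}\left(\tfrac{\mu}{L}\right)^{1-\nu}\right)^{N-k-1}\frac{\Delta_k^2}{\mu}.$$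
   Context: $L$-smooth: $\|\nabla f(x)-\nabla f(y)\|\le L\|x-y\|$ for all $x,y$. $\mu$-strongly convex: $f(y)\ge f(x)+\langle\nabla f(x),y-x\rangle+\frac\mu2\|y-x\|^2$ for all $x,y$. Intermediate Gradient Method (IGM) with parameters $L,\mu,\nu$ and starting point $x^0$: set $u^0=x^0$, $h=\frac1{4L}$, $s=1+\frac14\left(\frac{\mu}{2L}\right)^\nu$, $m=1-\frac14\left(\frac{\mu}{2L}\right)^\nu$, $q=\frac{\mu}{16L}$, and $\omega=\frac{(m-s)+\sqrt{(s-m)^2+4mq}}{2m}$. For $k=0,\dots,N-1$: $$y^k=\frac{\omega u^k+x^k}{1+\omega},\qquad u^{k+1}=(1-\omega)u^k+\omega y^k-\frac{2\omega}{\mu}\widetilde\nabla f(y^k),\qquad x^{k+1}=y^k-h\,\widetilde\nabla f(y^k).$$ Output $x^N$. *)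

theory Defs
  imports "HOL-Analysis.Analysis"
begin

definition grad :: "('a::real_inner \<Rightarrow> real) \<Rightarrow> 'a \<Rightarrow> 'a" where
  "grad f x = (THE g. GDERIV f x :> g)"

lemma grad_eqI:
  assumes "GDERIV f x :> g"
  shows "grad f x = g"
  unfolding grad_def
proof (rule the_equality)
  show "GDERIV f x :> g" by fact
next
  fix g' assume g': "GDERIV f x :> g'"
  have "(\<lambda>h. inner h g') = (\<lambda>h. inner h g)"
    using g' assms has_derivative_unique unfolding gderiv_def by blast
  then have "inner h (g' - g) = 0" for h
    by (metis inner_diff_right right_minus_eq)
  then have "inner (g' - g) (g' - g) = 0" by blast
  then show "g' = g" by simp
qed

lemma differentiable_GDERIV_grad:
  fixes f :: "'a::euclidean_space \<Rightarrow> real"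
  assumes "f differentiable (at x)"
  shows "GDERIV f x :> grad f x"
proof -
  obtain D where D: "(f has_derivative D) (at x)"
    using assms unfolding differentiable_def by blast
  interpret D: bounded_linear D using D by (rule has_derivative_bounded_linear)
  define g where "g = (\<Sum>b\<in>Basis. D b *\<^sub>R b)"
  have "D h = inner h g" for h
  proof -
    have "D h = D (\<Sum>b\<in>Basis. inner h b *\<^sub>R b)" by (simp add: euclidean_representation)
    also have "\<dots> = (\<Sum>b\<in>Basis. inner h b * D b)" by (simp add: D.sum D.scaleR)
    also have "\<dots> = inner h g" by (simp add: g_def inner_sum_right mult.commute)
    finally show ?thesis .
  qed
  then have "D = (\<lambda>h. inner h g)" by blast
  then have "GDERIV f x :> g" using D by (simp add: gderiv_def)
  then show ?thesis using grad_eqI by metis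
qed

text \<open>The next two predicates are meant for functions that are differentiable everywhere;
  differentiability is assumed separately.\<close>

definition L_smooth :: "real \<Rightarrow> ('a::real_inner \<Rightarrow> real) \<Rightarrow> bool" where
  "L_smooth L f \<longleftrightarrow> (\<forall>x y. norm (grad f x - grad f y) \<le> L * norm (x - y))"

definition strongly_convex :: "real \<Rightarrow> ('a::real_inner \<Rightarrow> real) \<Rightarrow> bool" where
  "strongly_convex \<mu> f \<longleftrightarrow>
     (\<forall>x y. f y \<ge> f x + inner (grad f x) (y - x) + \<mu> / 2 * (norm (y - x))\<^sup>2)"

definition igm_h :: "real \<Rightarrow> real" where
  "igm_h L = 1 / (4 * L)"

definition igm_s :: "real \<Rightarrow> real \<Rightarrow> real \<Rightarrow> real" where
  "igm_s L \<mu> \<nu> = 1 + 1 / 4 * (\<mu> / (2 * L)) powr \<nu>"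

definition igm_m :: "real \<Rightarrow> real \<Rightarrow> real \<Rightarrow> real" where
  "igm_m L \<mu> \<nu> = 1 - 1 / 4 * (\<mu> / (2 * L)) powr \<nu>"

definition igm_q :: "real \<Rightarrow> real \<Rightarrow> real" where
  "igm_q L \<mu> = \<mu> / (16 * L)"

definition igm_omega :: "real \<Rightarrow> real \<Rightarrow> real \<Rightarrow> real" where
  "igm_omega L \<mu> \<nu> =
     (let s = igm_s L \<mu> \<nu>; m = igm_m L \<mu> \<nu>; q = igm_q L \<mu>
      in ((m - s) + sqrt ((s - m)\<^sup>2 + 4 * m * q)) / (2 * m))"

text \<open>The extrapolated point computed from the pair (u, x).\<close>

definition igm_extrapolate :: "real \<Rightarrow> 'a::real_vector \<times> 'a \<Rightarrow> 'a" where
  "igm_extrapolate \<omega> ux = (\<omega> *\<^sub>R fst ux + snd ux) /\<^sub>R (1 + \<omega>)"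

text \<open>The state after k steps is the pair of the k-th iterates u and x.  The inexact gradient
  oracle G may depend on the iteration: G k is the oracle queried at step k.\<close>

primrec igm_state ::
  "real \<Rightarrow> real \<Rightarrow> real \<Rightarrow> (nat \<Rightarrow> 'a \<Rightarrow> 'a) \<Rightarrow> 'a \<Rightarrow> nat \<Rightarrow> 'a::real_vector \<times> 'a" where
  "igm_state L \<mu> \<nu> G x0 0 = (x0, x0)"
| "igm_state L \<mu> \<nu> G x0 (Suc k) =
     (let \<omega> = igm_omega L \<mu> \<nu>;
          u = fst (igm_state L \<mu> \<nu> G x0 k);
          y = igm_extrapolate \<omega> (igm_state L \<mu> \<nu> G x0 k)
      in ((1 - \<omega>) *\<^sub>R u + \<omega> *\<^sub>R y - (2 * \<omega> / \<mu>) *\<^sub>R G k y,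
          y - igm_h L *\<^sub>R G k y))"

definition igm_x ::
  "real \<Rightarrow> real \<Rightarrow> real \<Rightarrow> (nat \<Rightarrow> 'a \<Rightarrow> 'a) \<Rightarrow> 'a \<Rightarrow> nat \<Rightarrow> 'a::real_vector" where
  "igm_x L \<mu> \<nu> G x0 k = snd (igm_state L \<mu> \<nu> G x0 k)"

definition igm_y ::
  "real \<Rightarrow> real \<Rightarrow> real \<Rightarrow> (nat \<Rightarrow> 'a \<Rightarrow> 'a) \<Rightarrow> 'a \<Rightarrow> nat \<Rightarrow> 'a::real_vector" where
  "igm_y L \<mu> \<nu> G x0 k = igm_extrapolate (igm_omega L \<mu> \<nu>) (igm_state L \<mu> \<nu> G x0 k)"

end

theory Submission
  imports Defs
begin

text \<open>
  The proof is a Lyapunov argument for the potential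
  \<open>V k = f (x k) - f x\<^sup>* + \<mu> / 4 * \<parallel>u k - x\<^sup>*\<parallel>\<^sup>2\<close>.  The weight is \<open>\<mu> / 4\<close> and not
  \<open>\<mu> / 2\<close> because half of the strong convexity is kept to pay for the gradient error.

  In one step, put \<open>z = u - y\<close>, \<open>d = x\<^sup>* - y\<close> and let \<open>e\<close> be the error of the gradient at \<open>y\<close>.
  The extrapolation rule says exactly that \<open>x = y - \<omega> z\<close>.  When the convexity
  inequalities from \<open>y\<close> to \<open>x\<^sup>*\<close> (weight \<open>\<omega>\<close>) and from \<open>y\<close> to \<open>x\<close> (weight \<open>1 - \<omega>\<close>) are
  added to the expansion of \<open>\<parallel>u\<^sup>+ - x\<^sup>*\<parallel>\<^sup>2\<close>, the exact gradient cancels against \<open>z\<close> and \<open>d\<close>, and only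
  \<open>\<omega> \<langle>d, e\<rangle> - \<omega> (1 - \<omega>) \<langle>z, e\<rangle>\<close> remains.  Both terms carry the factor \<open>\<omega>\<close>, so
  Young's inequality against the negative quadratic terms in \<open>z\<close> and \<open>d\<close> costs at most \<open>2 \<omega> \<parallel>e\<parallel>\<^sup>2 / \<mu>\<close>.  The gradient step
  \<open>h = 1 / (4 L)\<close> absorbs the term \<open>\<omega>\<^sup>2 / \<mu> * \<parallel>g + e\<parallel>\<^sup>2\<close> as long as \<open>\<omega>\<^sup>2 \<le> \<mu> / (32 L)\<close>
  and leaves \<open>\<parallel>e\<parallel>\<^sup>2 / (8 L)\<close>.  Hence (\<open>igm_step_potential\<close>)
  \<open>V (k + 1) \<le> (1 - \<omega>) V k + (2 \<omega> / \<mu> + 1 / (8 L)) \<Delta>\<^sub>k\<^sup>2\<close>.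

  The parameter \<open>\<omega>\<close> is the positive root of \<open>m \<omega>\<^sup>2 + (s - m) \<omega> = q\<close>, and with
  \<open>a = \<mu> / (2 L)\<close> and \<open>\<nu> \<le> 1 / 2\<close> the linear term dominates up to constants, so that \<open>\<omega>\<close> lies
  between \<open>a\<^bsup>1 - \<nu>\<^esup> / 8\<close> and \<open>a\<^bsup>1 - \<nu>\<^esup> / 4\<close>
  (\<open>igm_omega_lower\<close>, \<open>igm_omega_upper\<close>).  The lower bound is the
  contraction rate; the upper bound gives both the condition on \<open>\<omega>\<^sup>2\<close> and
  the error constant.  Unrolling the recurrence gives the first estimate.  The second one only
  uses \<open>2\<^bsup>1 - \<nu>\<^esup> \<le> 2\<close> and the bound of the initial potential by \<open>L R\<^sup>2\<close>.
\<close>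

section \<open>Smooth strongly convex functions\<close>

lemma L_smoothD:
  "L_smooth L f \<Longrightarrow> norm (grad f x - grad f y) \<le> L * norm (x - y)"
  unfolding L_smooth_def by blast

lemma strongly_convexD:
  "strongly_convex \<mu> f \<Longrightarrow>
     f x + inner (grad f x) (y - x) + \<mu> / 2 * (norm (y - x))\<^sup>2 \<le> f y"
  unfolding strongly_convex_def by blast

text \<open>A quadratic upper bound with constant \<open>L\<close> in place of the sharp \<open>L / 2\<close>: convexity bounds
  \<open>f (y + v) - f y\<close> by the slope at the far end, and smoothness moves that slope back to \<open>y\<close>.
  The step size \<open>1 / (4 L)\<close> is short enough for the factor of two to be harmless.\<close>

lemma smooth_convex_upper_bound:
  assumes "0 \<le> \<mu>" "L_smooth L f" "strongly_convex \<mu> f"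
  shows "f (y + v) \<le> f y + inner (grad f y) v + L * (norm v)\<^sup>2"
proof -
  have "0 \<le> \<mu> / 2 * (norm v)\<^sup>2"
    using assms(1) by simp
  then have "f (y + v) - inner (grad f (y + v)) v \<le> f y"
    using strongly_convexD[OF assms(3), of "y + v" y] by simp
  moreover have "inner (grad f (y + v) - grad f y) v \<le> L * (norm v)\<^sup>2"
  proof -
    have "inner (grad f (y + v) - grad f y) v \<le> norm (grad f (y + v) - grad f y) * norm v"
      by (rule norm_cauchy_schwarz)
    also have "\<dots> \<le> (L * norm v) * norm v"
      using L_smoothD[OF assms(2), of "y + v" y] by (intro mult_right_mono) auto
    finally show ?thesis
      by (simp add: power2_eq_square mult.assoc)
  qed
  ultimately show ?thesis
    by (simp add: inner_diff_left)
qed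

lemma grad_minimizer_eq_0:
  assumes "0 \<le> \<mu>" "0 < L" "L_smooth L f" "strongly_convex \<mu> f"
    and min: "\<And>x. f xs \<le> f x"
  shows "grad f xs = 0"
proof -
  let ?g = "grad f xs"
  \<comment> \<open>A gradient step of length \<open>1 / (2 L)\<close> would decrease \<open>f\<close> by at least \<open>\<parallel>?g\<parallel>\<^sup>2 / (4 L)\<close>.\<close>
  let ?v = "- (1 / (2 * L)) *\<^sub>R ?g"
  have "f xs \<le> f xs + inner ?g ?v + L * (norm ?v)\<^sup>2"
    using smooth_convex_upper_bound[OF assms(1,3,4)] min order_trans by blast
  moreover have "inner ?g ?v + L * (norm ?v)\<^sup>2 = - (norm ?g)\<^sup>2 / (4 * L)"
    using assms(2)
    by (simp add: dot_square_norm power_mult_distrib power_divide) (simp add: field_simps power2_eq_square)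
  ultimately have "(norm ?g)\<^sup>2 / (4 * L) \<le> 0"
    by simp
  then have "(norm ?g)\<^sup>2 \<le> 0"
    using assms(2) by (simp add: divide_le_0_iff)
  then show ?thesis
    by simp
qed

text \<open>Convexity and smoothness give \<open>f x - f xs \<le> L * \<parallel>x - xs\<parallel>\<^sup>2\<close>; strong convexity improves
  this by \<open>\<mu> / 2 * \<parallel>x - xs\<parallel>\<^sup>2\<close>, a surplus that covers the distance term.\<close>

lemma potential_le_smoothness:
  assumes "0 \<le> \<mu>" "0 < L" "L_smooth L f" "strongly_convex \<mu> f" "\<And>x. f xs \<le> f x"
  shows "f x - f xs + \<mu> / 4 * (norm (x - xs))\<^sup>2 \<le> L * (norm (x - xs))\<^sup>2"
proof -
  have g0: "grad f xs = 0"
    using grad_minimizer_eq_0[OF assms] .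
  have "inner (grad f x) (x - xs) \<le> norm (grad f x) * norm (x - xs)"
    by (rule norm_cauchy_schwarz)
  also have "\<dots> \<le> (L * norm (x - xs)) * norm (x - xs)"
    using L_smoothD[OF assms(3), of x xs] g0 by (intro mult_right_mono) auto
  finally have "inner (grad f x) (x - xs) \<le> L * (norm (x - xs))\<^sup>2"
    by (simp add: power2_eq_square mult.assoc)
  moreover have "f x - inner (grad f x) (x - xs) + \<mu> / 2 * (norm (x - xs))\<^sup>2 \<le> f xs"
    using strongly_convexD[OF assms(4), of x xs] by (simp add: inner_diff_right norm_minus_commute)
  moreover have "0 \<le> \<mu> / 4 * (norm (x - xs))\<^sup>2"
    using assms(1) by simp
  ultimately show ?thesis
    by simp
qed

section \<open>One step of the method\<close>

lemma young_inner:
  fixes a b :: "'a::real_inner"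
  assumes "0 < c"
  shows "inner a b \<le> c / 4 * (norm a)\<^sup>2 + (norm b)\<^sup>2 / c"
proof -
  have "0 \<le> (norm ((c / 2) *\<^sub>R a - b))\<^sup>2 / c"
    using assms by simp
  also have "\<dots> = c / 4 * (norm a)\<^sup>2 + (norm b)\<^sup>2 / c - inner a b"
    using assms unfolding power2_norm_eq_inner
    by (simp add: inner_diff_left inner_diff_right inner_commute[of b a] field_simps)
  finally show ?thesis
    by simp
qed

text \<open>The step is written in coordinates centred at the extrapolated point \<open>y\<close>: the previous
  iterates are \<open>u = y + z\<close> and \<open>x = y - \<omega> z\<close>, and the comparison point is \<open>y + d\<close>.\<close>

lemma igm_step_potential_centred:
  fixes y z d e :: "'a::real_inner"
  assumes "0 < \<mu>" "0 < L" and sm: "L_smooth L f" and sc: "strongly_convex \<mu> f"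
    and w: "0 \<le> w" "w \<le> 1" "w\<^sup>2 / \<mu> \<le> 1 / (32 * L)"
  defines "gt \<equiv> grad f y + e"
  shows "f (y - (1 / (4 * L)) *\<^sub>R gt) - f (y + d)
           + \<mu> / 4 * (norm ((1 - w) *\<^sub>R z - d - (2 * w / \<mu>) *\<^sub>R gt))\<^sup>2
         \<le> (1 - w) * (f (y - w *\<^sub>R z) - f (y + d) + \<mu> / 4 * (norm (z - d))\<^sup>2)
           + (2 * w / \<mu> + 1 / (8 * L)) * (norm e)\<^sup>2"
proof -
  let ?g = "grad f y"
  let ?D = "inner d d" and ?Z = "inner z z" and ?E = "inner e e" and ?T = "inner gt gt"
  have to_min: "w * (f y + inner ?g d + \<mu> / 2 * ?D) \<le> w * f (y + d)"
    using strongly_convexD[OF sc, of y "y + d"] w(1)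
    by (intro mult_left_mono) (simp_all add: power2_norm_eq_inner)
  have to_prev: "(1 - w) * (f y - w * inner ?g z) \<le> (1 - w) * f (y - w *\<^sub>R z)"
  proof (intro mult_left_mono)
    have "0 \<le> \<mu> / 2 * (norm (w *\<^sub>R z))\<^sup>2"
      using assms(1) by simp
    then show "f y - w * inner ?g z \<le> f (y - w *\<^sub>R z)"
      using strongly_convexD[OF sc, of y "y - w *\<^sub>R z"] by simp
  qed (use w in simp)
  have descent: "f (y - (1 / (4 * L)) *\<^sub>R gt) \<le> f y - 1 / (4 * L) * inner ?g gt + 1 / (16 * L) * ?T"
  proof -
    have "L * (norm (- (1 / (4 * L)) *\<^sub>R gt))\<^sup>2 = 1 / (16 * L) * ?T"
      using assms(2) by (simp add: dot_square_norm power_mult_distrib power_divide) (simp add: field_simps power2_eq_square)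
    then show ?thesis
      using smooth_convex_upper_bound[OF less_imp_le[OF assms(1)] sm sc, of y "- (1 / (4 * L)) *\<^sub>R gt"]
      by simp
  qed
  have "2 * inner ?g gt = inner ?g ?g + ?T - ?E"
    by (simp add: gt_def inner_simps inner_commute)
  then have polar: "?T - ?E \<le> 2 * inner ?g gt"
    using inner_ge_zero[of ?g] by linarith
  have expand: "\<mu> / 4 * (norm ((1 - w) *\<^sub>R z - d - (2 * w / \<mu>) *\<^sub>R gt))\<^sup>2
      = \<mu> / 4 * ((1 - w)\<^sup>2 * ?Z - 2 * (1 - w) * inner z d + ?D)
        - w * (1 - w) * inner z gt + w * inner d gt + w\<^sup>2 / \<mu> * ?T"
  proof -
    have "(norm ((1 - w) *\<^sub>R z - d - c *\<^sub>R gt))\<^sup>2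
        = (1 - w)\<^sup>2 * ?Z - 2 * (1 - w) * inner z d + ?D - 2 * c * (1 - w) * inner z gt
          + 2 * c * inner d gt + c\<^sup>2 * ?T" for c
      by (simp add: power2_norm_eq_inner inner_diff_left inner_diff_right inner_commute[of d z]
          inner_commute[of gt z] inner_commute[of gt d])
        (simp add: algebra_simps power2_eq_square)
    from this[of "2 * w / \<mu>"] show ?thesis
      using assms(1) by (simp only:) (simp add: field_simps power2_eq_square)
  qed
  have prev: "(norm (z - d))\<^sup>2 = ?Z - 2 * inner z d + ?D"
    unfolding power2_norm_eq_inner by (simp add: inner_simps inner_commute)
  have young_d: "w * inner d e \<le> w * (\<mu> / 4 * ?D + ?E / \<mu>)"
    using young_inner[OF assms(1), of d e] w(1)
    by (intro mult_left_mono) (simp_all add: power2_norm_eq_inner)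
  have young_z: "w * (1 - w) * (- inner z e) \<le> w * (1 - w) * (\<mu> / 4 * ?Z + ?E / \<mu>)"
    using young_inner[OF assms(1), of "- z" e] w(1,2)
    by (intro mult_left_mono) (simp_all add: power2_norm_eq_inner)
  have "w * (1 - w) * (?E / \<mu>) \<le> w * (?E / \<mu>)"
    using w assms(1) by (intro mult_right_mono) (simp_all add: mult_left_le)
  then have young_z': "- (w * (1 - w) * inner z e) \<le> w * (1 - w) * (\<mu> / 4 * ?Z) + w * (?E / \<mu>)"
    using young_z by (simp add: algebra_simps)
  have split: "inner z gt = inner ?g z + inner z e" "inner d gt = inner ?g d + inner d e"
    by (simp_all add: gt_def inner_simps inner_commute)
  have wT: "w\<^sup>2 / \<mu> * ?T \<le> 1 / (32 * L) * ?T"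
    using w(3) by (intro mult_right_mono) simp_all
  \<comment> \<open>Of the \<open>?T / (8 L)\<close> gained by polarisation, the quadratic term of the gradient step
    uses \<open>?T / (16 L)\<close> and the expansion of \<open>u\<close> at most \<open>?T / (32 L)\<close>.\<close>
  have grad_terms: "- (1 / (4 * L) * inner ?g gt) + 1 / (16 * L) * ?T + w\<^sup>2 / \<mu> * ?T \<le> 1 / (8 * L) * ?E"
  proof -
    have "1 / (8 * L) * (?T - ?E) \<le> 1 / (8 * L) * (2 * inner ?g gt)"
      using polar assms(2) by (intro mult_left_mono) simp_all
    moreover have "1 / (8 * L) * ?T = 1 / (16 * L) * ?T + 1 / (32 * L) * ?T + 1 / (32 * L) * ?T"
      using assms(2) by (simp add: field_simps)
    moreover have "0 \<le> 1 / (32 * L) * ?T"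
      using assms(2) by simp
    ultimately show ?thesis
      using wT by (simp add: right_diff_distrib)
  qed
  \<comment> \<open>Convexity of the squared norm, with its defect \<open>w (1 - w) \<parallel>z\<parallel>\<^sup>2\<close>, which absorbs the error along \<open>z\<close>.\<close>
  have mix: "\<mu> / 4 * ((1 - w)\<^sup>2 * ?Z - 2 * (1 - w) * inner z d + ?D)
      = (1 - w) * (\<mu> / 4 * (?Z - 2 * inner z d + ?D)) + w * (\<mu> / 4 * ?D) - w * (1 - w) * (\<mu> / 4 * ?Z)"
    by (simp add: field_simps power2_eq_square)
  define \<epsilon> where "\<epsilon> = ?E / \<mu>"
  have cost: "(2 * w / \<mu> + 1 / (8 * L)) * ?E = w * \<epsilon> + w * \<epsilon> + 1 / (8 * L) * ?E"
    by (simp add: \<epsilon>_def distrib_right)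
  show ?thesis
    unfolding expand prev mix split power2_norm_eq_inner[of e] cost
    using to_min to_prev descent young_d[folded \<epsilon>_def] young_z'[folded \<epsilon>_def] grad_terms
    by (simp add: algebra_simps)
qed

lemma igm_step_potential:
  fixes x u xs gt :: "'a::real_inner"
  assumes "0 < \<mu>" "0 < L" "L_smooth L f" "strongly_convex \<mu> f"
    and w: "0 \<le> w" "w \<le> 1" "w\<^sup>2 / \<mu> \<le> 1 / (32 * L)"
  defines "y \<equiv> igm_extrapolate w (u, x)"
  assumes err: "norm (gt - grad f y) \<le> \<delta>"
  shows "f (y - igm_h L *\<^sub>R gt) - f xs
           + \<mu> / 4 * (norm ((1 - w) *\<^sub>R u + w *\<^sub>R y - (2 * w / \<mu>) *\<^sub>R gt - xs))\<^sup>2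
         \<le> (1 - w) * (f x - f xs + \<mu> / 4 * (norm (u - xs))\<^sup>2) + (2 * w / \<mu> + 1 / (8 * L)) * \<delta>\<^sup>2"
proof -
  have "(1 + w) *\<^sub>R y = w *\<^sub>R u + x"
    using w(1) by (simp add: y_def igm_extrapolate_def)
  then have x: "y - w *\<^sub>R (u - y) = x"
    by (simp add: algebra_simps)
  have u': "(1 - w) *\<^sub>R (u - y) - (xs - y) - (2 * w / \<mu>) *\<^sub>R gt
      = (1 - w) *\<^sub>R u + w *\<^sub>R y - (2 * w / \<mu>) *\<^sub>R gt - xs"
    by (simp add: algebra_simps)
  have "(2 * w / \<mu> + 1 / (8 * L)) * (norm (gt - grad f y))\<^sup>2 \<le> (2 * w / \<mu> + 1 / (8 * L)) * \<delta>\<^sup>2"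
    using err assms(1,2) w(1) by (intro mult_left_mono power_mono) simp_all
  then show ?thesis
    using igm_step_potential_centred[OF assms(1-4) w, where y = y and z = "u - y" and d = "xs - y"
        and e = "gt - grad f y"]
    by (simp add: x u' igm_h_def)
qed

section \<open>Size of the extrapolation parameter\<close>

lemma igm_omega_root:
  assumes "0 < \<mu>" "\<mu> \<le> L" "0 \<le> \<nu>"
  defines "a \<equiv> \<mu> / (2 * L)" and "w \<equiv> igm_omega L \<mu> \<nu>"
  shows "0 \<le> w" and "(1 - a powr \<nu> / 4) * w\<^sup>2 + a powr \<nu> / 2 * w = a / 8"
proof -
  define m where "m = 1 - a powr \<nu> / 4"
  define b where "b = a powr \<nu> / 2"
  have a: "0 < a" "a \<le> 1"
    using assms(1,2) by (simp_all add: a_def field_simps)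
  then have p: "0 < a powr \<nu>" "a powr \<nu> \<le> 1"
    using assms(3) by (simp_all add: powr_le1)
  have m: "0 < m" and b: "0 \<le> b"
    using p by (simp_all add: m_def b_def)
  define r where "r = sqrt (b\<^sup>2 + 4 * m * (a / 8))"
  have "igm_q L \<mu> = a / 8"
    by (simp add: igm_q_def a_def)
  then have w: "w = (r - b) / (2 * m)"
    unfolding w_def igm_omega_def igm_s_def igm_m_def Let_def r_def m_def b_def a_def[symmetric]
    by simp
  have disc: "0 \<le> 4 * m * (a / 8)"
    using m a by simp
  have "b \<le> r"
    unfolding r_def by (rule real_le_rsqrt) (use disc in simp)
  then show "0 \<le> w"
    using m by (simp add: w)
  have "r\<^sup>2 = b\<^sup>2 + 4 * m * (a / 8)"
    unfolding r_def by (rule real_sqrt_pow2) (use disc in simp)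
  moreover have "m * w\<^sup>2 + b * w = (r\<^sup>2 - b\<^sup>2) / (4 * m)"
    using m unfolding w by (simp add: field_simps power2_eq_square)
  ultimately have "m * w\<^sup>2 + b * w = a / 8"
    using m by simp
  then show "(1 - a powr \<nu> / 4) * w\<^sup>2 + a powr \<nu> / 2 * w = a / 8"
    by (simp add: m_def b_def)
qed

text \<open>Dropping the quadratic term of the defining equation bounds \<open>\<omega>\<close> from above.\<close>

lemma igm_omega_upper:
  assumes "0 < \<mu>" "\<mu> \<le> L" "0 \<le> \<nu>"
  shows "igm_omega L \<mu> \<nu> \<le> 1 / 4 * (\<mu> / (2 * L)) powr (1 - \<nu>)"
proof -
  define a where "a = \<mu> / (2 * L)"
  define w where "w = igm_omega L \<mu> \<nu>"
  have a: "0 < a" "a \<le> 1"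
    using assms(1,2) by (simp_all add: a_def field_simps)
  then have p: "0 < a powr \<nu>" "a powr \<nu> \<le> 1"
    using assms(3) by (simp_all add: powr_le1)
  have "0 \<le> (1 - a powr \<nu> / 4) * w\<^sup>2"
    using p by (intro mult_nonneg_nonneg) simp_all
  then have "a powr \<nu> / 2 * w \<le> a / 8"
    using igm_omega_root(2)[OF assms] by (simp add: a_def w_def)
  then have "w \<le> 1 / 4 * (a / a powr \<nu>)"
    using p by (simp add: field_simps)
  also have "a / a powr \<nu> = a powr (1 - \<nu>)"
    using a by (simp add: powr_diff)
  finally show ?thesis
    by (simp add: w_def a_def)
qed

text \<open>For \<open>\<nu> \<le> 1 / 2\<close> we have \<open>a \<le> (a\<^bsup>\<nu>\<^esup>)\<^sup>2\<close>, so at half of the upper bound the quadratic term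
  still takes less than the remaining half of \<open>a / 8\<close>.\<close>

lemma igm_omega_lower:
  assumes "0 < \<mu>" "\<mu> \<le> L" "0 \<le> \<nu>" "\<nu> \<le> 1 / 2"
  shows "1 / 8 * (\<mu> / (2 * L)) powr (1 - \<nu>) \<le> igm_omega L \<mu> \<nu>"
proof -
  define a where "a = \<mu> / (2 * L)"
  define w where "w = igm_omega L \<mu> \<nu>"
  define p where "p = a powr \<nu>"
  have a: "0 < a" "a \<le> 1"
    using assms(1,2) by (simp_all add: a_def field_simps)
  then have p: "0 < p" "p \<le> 1"
    using assms(3) by (simp_all add: p_def powr_le1)
  have root: "0 \<le> w" "(1 - p / 4) * w\<^sup>2 + p / 2 * w = a / 8"
    using igm_omega_root[OF assms(1-3)] by (simp_all add: a_def w_def p_def)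
  have "p\<^sup>2 = a powr (2 * \<nu>)"
    by (simp add: p_def power2_eq_square flip: powr_add)
  moreover have "a powr 1 \<le> a powr (2 * \<nu>)"
    using a assms(4) by (intro powr_mono') simp_all
  ultimately have ap: "a \<le> p\<^sup>2"
    using a by simp
  have "a / (8 * p) \<le> w"
  proof (rule ccontr)
    assume "\<not> a / (8 * p) \<le> w"
    then have lt: "w < a / (8 * p)"
      by simp
    then have half: "p / 2 * w < a / 16"
      using p by (simp add: field_simps)
    have "(1 - p / 4) * w\<^sup>2 \<le> 1 * (a / (8 * p))\<^sup>2"
      using p lt root(1) by (intro mult_mono power_mono) simp_all
    also have "\<dots> = a * a / (64 * p\<^sup>2)"
      by (simp add: power2_eq_square)
    also have "\<dots> \<le> a * p\<^sup>2 / (64 * p\<^sup>2)"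
      using ap a by (intro divide_right_mono mult_left_mono) simp_all
    also have "\<dots> = a / 64"
      using p by simp
    finally show False
      using half root(2) a by simp
  qed
  moreover have "a / (8 * p) = 1 / 8 * a powr (1 - \<nu>)"
    using a by (simp add: p_def powr_diff)
  ultimately show ?thesis
    by (simp add: w_def a_def)
qed

lemma igm_omega_square:
  assumes "0 < \<mu>" "\<mu> \<le> L" "0 \<le> \<nu>" "\<nu> \<le> 1 / 2"
  shows "(igm_omega L \<mu> \<nu>)\<^sup>2 / \<mu> \<le> 1 / (32 * L)"
proof -
  define a where "a = \<mu> / (2 * L)"
  have a: "0 < a" "a \<le> 1"
    using assms(1,2) by (simp_all add: a_def field_simps)
  have "(igm_omega L \<mu> \<nu>)\<^sup>2 \<le> (1 / 4 * a powr (1 - \<nu>))\<^sup>2"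
    using igm_omega_upper[OF assms(1-3)] igm_omega_root(1)[OF assms(1-3)]
    by (intro power_mono) (simp_all add: a_def)
  also have "\<dots> = 1 / 16 * a powr (2 * (1 - \<nu>))"
    by (simp add: power2_eq_square flip: powr_add)
  also have "\<dots> \<le> 1 / 16 * a powr 1"
    using a assms(4) by (intro mult_left_mono powr_mono') simp_all
  finally show ?thesis
    using a assms(1,2) by (simp add: a_def field_simps)
qed

text \<open>Both parts of the error coefficient are dominated by \<open>a\<^bsup>1 - 2 \<nu>\<^esup>\<close>, because \<open>a \<le> 1\<close> makes
  the powers \<open>a\<^bsup>1 - \<nu>\<^esup>\<close> and \<open>a\<close> smaller.\<close>

lemma igm_error_coefficient:
  assumes "0 < \<mu>" "\<mu> \<le> L" "0 \<le> \<nu>" "\<nu> \<le> 1 / 2"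
  shows "2 * igm_omega L \<mu> \<nu> / \<mu> + 1 / (8 * L) \<le> 3 * (\<mu> / L) powr (1 - 2 * \<nu>) / \<mu>"
proof -
  define a where "a = \<mu> / (2 * L)"
  have a: "0 < a" "a \<le> 1"
    using assms(1,2) by (simp_all add: a_def field_simps)
  have "a powr (1 - \<nu>) \<le> a powr (1 - 2 * \<nu>)" "a powr 1 \<le> a powr (1 - 2 * \<nu>)"
    using a assms(3) by (intro powr_mono'; simp)+
  moreover have "a powr (1 - 2 * \<nu>) \<le> (\<mu> / L) powr (1 - 2 * \<nu>)"
    using a assms by (intro powr_mono2) (simp_all add: a_def field_simps)
  moreover have "0 \<le> a powr (1 - 2 * \<nu>)"
    by simp
  ultimately have "2 * igm_omega L \<mu> \<nu> + a / 4 \<le> 3 * (\<mu> / L) powr (1 - 2 * \<nu>)"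
    using igm_omega_upper[OF assms(1-3)] a by (simp add: a_def[symmetric])
  then have "(2 * igm_omega L \<mu> \<nu> + a / 4) / \<mu> \<le> 3 * (\<mu> / L) powr (1 - 2 * \<nu>) / \<mu>"
    using assms(1) by (intro divide_right_mono) simp_all
  then show ?thesis
    using assms(1,2) by (simp add: a_def add_divide_distrib)
qed

lemma halved_powr_rate:
  fixes \<mu> L \<nu> :: real
  assumes "0 < \<mu>" "\<mu> \<le> L" "0 \<le> \<nu>"
  shows "1 / 16 * (\<mu> / L) powr (1 - \<nu>) \<le> 1 / 8 * (\<mu> / (2 * L)) powr (1 - \<nu>)"
proof -
  have L: "0 < L"
    using assms(1,2) by linarith
  have "\<mu> / L = 2 * (\<mu> / (2 * L))"
    by simp
  then have "(\<mu> / L) powr (1 - \<nu>) = 2 powr (1 - \<nu>) * (\<mu> / (2 * L)) powr (1 - \<nu>)"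
    using assms(1) L by (metis powr_mult)
  also have "\<dots> \<le> 2 * (\<mu> / (2 * L)) powr (1 - \<nu>)"
    using assms(3) powr_mono[of "1 - \<nu>" 1 2] by (intro mult_right_mono) simp_all
  finally show ?thesis
    by simp
qed

section \<open>Convergence\<close>

lemma linear_recurrence_bound:
  fixes V c :: "nat \<Rightarrow> real"
  assumes "0 \<le> r" and "\<And>k. k < n \<Longrightarrow> V (Suc k) \<le> r * V k + c k"
  shows "V n \<le> r ^ n * V 0 + (\<Sum>k<n. r ^ (n - k - 1) * c k)"
  using assms(2)
proof (induction n)
  case (Suc n)
  have "V (Suc n) \<le> r * V n + c n"
    using Suc.prems by simp
  also have "\<dots> \<le> r * (r ^ n * V 0 + (\<Sum>k<n. r ^ (n - k - 1) * c k)) + c n"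
    using Suc assms(1) by (intro add_right_mono mult_left_mono) simp_all
  also have "\<dots> = r ^ Suc n * V 0 + (\<Sum>k<n. r * r ^ (n - k - 1) * c k) + c n"
    by (simp add: distrib_left sum_distrib_left mult.assoc)
  also have "(\<Sum>k<n. r * r ^ (n - k - 1) * c k) = (\<Sum>k<n. r ^ (Suc n - k - 1) * c k)"
    by (intro sum.cong refl) (simp add: Suc_diff_Suc flip: power_Suc)
  finally show ?case
    by simp
qed simp

theorem theorem1:
  fixes f :: "real ^ 'd \<Rightarrow> real"
    and L \<mu> \<nu> R :: real
    and x0 xstar :: "real ^ 'd"
    and G :: "nat \<Rightarrow> real ^ 'd \<Rightarrow> real ^ 'd"
    and \<Delta> :: "nat \<Rightarrow> real"
    and N :: nat
  assumes "0 < \<mu>" and "\<mu> \<le> L"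
    and "\<forall>x. f differentiable (at x)"
    and "L_smooth L f"
    and "strongly_convex \<mu> f"
    and "\<forall>x. f xstar \<le> f x"
    and "0 \<le> \<nu>" and "\<nu> \<le> 1 / 2"
    and "\<forall>k<N. norm (G k (igm_y L \<mu> \<nu> G x0 k) - grad f (igm_y L \<mu> \<nu> G x0 k)) \<le> \<Delta> k"
    and "R = norm (x0 - xstar)"
  shows "f (igm_x L \<mu> \<nu> G x0 N) - f xstar
      \<le> (1 - 1 / 8 * (\<mu> / (2 * L)) powr (1 - \<nu>)) ^ N * (f x0 - f xstar + \<mu> / 4 * R\<^sup>2)
        + 3 * (\<mu> / L) powr (1 - 2 * \<nu>)
          * (\<Sum>k<N. (1 - 1 / 8 * (\<mu> / (2 * L)) powr (1 - \<nu>)) ^ (N - k - 1) * ((\<Delta> k)\<^sup>2 / \<mu>))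
    \<and> (1 - 1 / 8 * (\<mu> / (2 * L)) powr (1 - \<nu>)) ^ N * (f x0 - f xstar + \<mu> / 4 * R\<^sup>2)
        + 3 * (\<mu> / L) powr (1 - 2 * \<nu>)
          * (\<Sum>k<N. (1 - 1 / 8 * (\<mu> / (2 * L)) powr (1 - \<nu>)) ^ (N - k - 1) * ((\<Delta> k)\<^sup>2 / \<mu>))
      \<le> (1 - 1 / 16 * (\<mu> / L) powr (1 - \<nu>)) ^ N * (L * R\<^sup>2)
        + 3 * (\<mu> / L) powr (1 - 2 * \<nu>)
          * (\<Sum>k<N. (1 - 1 / 16 * (\<mu> / L) powr (1 - \<nu>)) ^ (N - k - 1) * ((\<Delta> k)\<^sup>2 / \<mu>))"
proof -
  define \<omega> where "\<omega> = igm_omega L \<mu> \<nu>"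
  define \<rho> where "\<rho> = 1 / 8 * (\<mu> / (2 * L)) powr (1 - \<nu>)"
  define \<sigma> where "\<sigma> = 1 / 16 * (\<mu> / L) powr (1 - \<nu>)"
  define C where "C = 3 * (\<mu> / L) powr (1 - 2 * \<nu>)"
  define u where "u k = fst (igm_state L \<mu> \<nu> G x0 k)" for k
  define x where "x k = snd (igm_state L \<mu> \<nu> G x0 k)" for k
  define y where "y k = igm_y L \<mu> \<nu> G x0 k" for k
  define V where "V k = f (x k) - f xstar + \<mu> / 4 * (norm (u k - xstar))\<^sup>2" for k
  have L: "0 < L"
    using assms(1,2) by linarith
  have min: "\<And>z. f xstar \<le> f z"
    using assms(6) by blast
  have C: "0 \<le> C"
    by (simp add: C_def)
  have V_nonneg: "0 \<le> V k" for k
    using min[of "x k"] assms(1) by (simp add: V_def)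
  have "(\<mu> / (2 * L)) powr (1 - \<nu>) \<le> 1"
    using assms(1,2,8) L by (intro powr_le1) (simp_all add: field_simps)
  then have \<rho>1: "\<rho> \<le> 1" and \<omega>1: "\<omega> \<le> 1"
    using igm_omega_upper[OF assms(1,2,7)] by (simp_all add: \<rho>_def \<omega>_def)
  have \<sigma>\<rho>: "\<sigma> \<le> \<rho>"
    using halved_powr_rate[OF assms(1,2,7)] by (simp add: \<rho>_def \<sigma>_def)
  have step: "V (Suc k) \<le> (1 - \<rho>) * V k + C * ((\<Delta> k)\<^sup>2 / \<mu>)" if "k < N" for k
  proof -
    have y: "igm_extrapolate \<omega> (u k, x k) = y k"
      by (simp add: y_def igm_y_def u_def x_def \<omega>_def)
    have x_Suc: "x (Suc k) = y k - igm_h L *\<^sub>R G k (y k)"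
      and u_Suc: "u (Suc k) = (1 - \<omega>) *\<^sub>R u k + \<omega> *\<^sub>R y k - (2 * \<omega> / \<mu>) *\<^sub>R G k (y k)"
      by (simp_all add: x_def u_def y_def igm_y_def \<omega>_def Let_def)
    have "norm (G k (y k) - grad f (y k)) \<le> \<Delta> k"
      using assms(9) that by (simp add: y_def)
    then have "V (Suc k) \<le> (1 - \<omega>) * V k + (2 * \<omega> / \<mu> + 1 / (8 * L)) * (\<Delta> k)\<^sup>2"
      using igm_step_potential[OF assms(1) L assms(4,5), of \<omega> "G k (y k)" "u k" "x k" "\<Delta> k" xstar]
        igm_omega_root(1)[OF assms(1,2,7), folded \<omega>_def]
        igm_omega_square[OF assms(1,2,7,8), folded \<omega>_def] \<omega>1
      by (simp add: y V_def x_Suc u_Suc)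
    also have "\<dots> \<le> (1 - \<rho>) * V k + C / \<mu> * (\<Delta> k)\<^sup>2"
      using igm_omega_lower[OF assms(1,2,7,8)] igm_error_coefficient[OF assms(1,2,7,8)] V_nonneg
      by (intro add_mono mult_right_mono) (simp_all add: \<rho>_def \<omega>_def C_def)
    finally show ?thesis
      by simp
  qed
  have V0: "V 0 = f x0 - f xstar + \<mu> / 4 * R\<^sup>2"
    by (simp add: V_def x_def u_def assms(10))
  have "f (igm_x L \<mu> \<nu> G x0 N) - f xstar \<le> V N"
    using assms(1) by (simp add: V_def x_def igm_x_def)
  also have "\<dots> \<le> (1 - \<rho>) ^ N * V 0 + (\<Sum>k<N. (1 - \<rho>) ^ (N - k - 1) * (C * ((\<Delta> k)\<^sup>2 / \<mu>)))"
    by (rule linear_recurrence_bound) (use \<rho>1 step in auto)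
  also have "\<dots> = (1 - \<rho>) ^ N * V 0 + C * (\<Sum>k<N. (1 - \<rho>) ^ (N - k - 1) * ((\<Delta> k)\<^sup>2 / \<mu>))"
    by (simp add: sum_distrib_left mult.left_commute)
  finally have first: "f (igm_x L \<mu> \<nu> G x0 N) - f xstar
      \<le> (1 - \<rho>) ^ N * V 0 + C * (\<Sum>k<N. (1 - \<rho>) ^ (N - k - 1) * ((\<Delta> k)\<^sup>2 / \<mu>))" .
  have "V 0 \<le> L * R\<^sup>2"
    unfolding V0 assms(10)
    using potential_le_smoothness[OF less_imp_le[OF assms(1)] L assms(4,5) min] .
  moreover have "(1 - \<rho>) ^ n \<le> (1 - \<sigma>) ^ n" for n
    using \<rho>1 \<sigma>\<rho> by (intro power_mono) simp_all
  ultimately have "(1 - \<rho>) ^ N * V 0 + C * (\<Sum>k<N. (1 - \<rho>) ^ (N - k - 1) * ((\<Delta> k)\<^sup>2 / \<mu>))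
      \<le> (1 - \<sigma>) ^ N * (L * R\<^sup>2) + C * (\<Sum>k<N. (1 - \<sigma>) ^ (N - k - 1) * ((\<Delta> k)\<^sup>2 / \<mu>))"
    using C V_nonneg \<sigma>\<rho> \<rho>1 assms(1)
    by (intro add_mono mult_mono mult_left_mono sum_mono mult_right_mono zero_le_power) simp_all
  then show ?thesis
    using first unfolding V0 \<rho>_def \<sigma>_def C_def by blast
qed

end
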